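(* Let $k \ge 1$ and $\theta = 2\pi/(4k+4)$, and let $R = 1 + \dfrac{2\sin(\theta/2)}{\cos(\theta/2) - \sin(\theta/2)}$. For every finite point set $P$ in general position and every $u, w \in P$, the path produced by $\theta$-routing from $u$ to $w$ in the $\theta_{4k+4}$-graph on $P$ has length at most $R\,|uw|$. Moreover the bound is tight: for every $\varepsilon > 0$ there exist $P$ and $u,w\in P$ for which the $\theta$-routing path from $u$ to $w$ has length at least $(R-\varepsilon)|uw|$.
   Context: Cones: for $m \ge 2$, $\theta = 2\pi/m$; around each point $u$ draw $m$ rays with consecutive angular separation $\theta$, oriented so the vertical upward ray from $u$ bisects a cone $C_0^u$; cones numbered clockwise, same orientation at every point. General position: no two points on a line parallel to a cone boundary ray, no two on a line perpendicular to a cone bisector, no three collinear. The $\theta_m$-graph on $P$: for each $u\in P$ and each cone $C_i^u$ containing another point of $P$, add an edge from $u$ to the point of $C_i^u$ whose orthogonal projection onto the bisector of $C_i^u$ is closest to $u$; edges weighted by Euclidean length. $\theta$-routing with destination $t$: at the current vertex $x$, if $xt$ is an edge of the graph, follow it; otherwise follow the edge from $x$ in the cone of $x$ that contains $t$ (i.e. to the closest vertex in that cone, measured by projection onto its bisector). *)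

theory Defs
  imports "HOL-Analysis.Analysis"
begin

text \<open>Points of the plane are complex numbers; dist is the Euclidean distance.
  m cones of angle theta = 2 pi / m around each point. Cone 0 is bisected by the
  vertical upward ray; cones are numbered clockwise, so the bisector of cone i
  has direction angle pi/2 - i*theta.\<close>

definition cone_angle :: "nat \<Rightarrow> real" where
  "cone_angle m = 2 * pi / real m"

definition bisector :: "nat \<Rightarrow> nat \<Rightarrow> complex" where
  "bisector m i = cis (pi / 2 - real i * cone_angle m)"

text \<open>Direction of the j-th cone boundary ray (the boundary between cones j-1 and j,
  i.e. the counterclockwise boundary of cone j).\<close>
definition boundary_dir :: "nat \<Rightarrow> nat \<Rightarrow> complex" where
  "boundary_dir m j = cis (pi / 2 + cone_angle m / 2 - real j * cone_angle m)"

text \<open>Index of the cone of u containing v (for v different from u); an index in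
  0..m-1. Cone i consists of the directions with angle in
  (pi/2 + theta/2 - (i+1) theta, pi/2 + theta/2 - i theta].\<close>
definition cone_idx :: "nat \<Rightarrow> complex \<Rightarrow> complex \<Rightarrow> nat" where
  "cone_idx m u v =
     nat \<lfloor>real m * frac ((pi / 2 + cone_angle m / 2 - Arg (v - u)) / (2 * pi))\<rfloor>"

definition proj_len :: "nat \<Rightarrow> nat \<Rightarrow> complex \<Rightarrow> complex \<Rightarrow> real" where
  "proj_len m i u v = Re ((v - u) * cnj (bisector m i))"

definition general_position :: "nat \<Rightarrow> complex set \<Rightarrow> bool" where
  "general_position m P \<longleftrightarrow>
     (\<forall>p\<in>P. \<forall>q\<in>P. p \<noteq> q \<longrightarrow>
        (\<forall>j<m. \<forall>r::real. q - p \<noteq> complex_of_real r * boundary_dir m j) \<and>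
        (\<forall>i<m. Re ((q - p) * cnj (bisector m i)) \<noteq> 0)) \<and>
     (\<forall>p\<in>P. \<forall>q\<in>P. \<forall>r\<in>P. p \<noteq> q \<and> q \<noteq> r \<and> p \<noteq> r \<longrightarrow> \<not> collinear {p, q, r})"

definition theta_edge :: "nat \<Rightarrow> complex set \<Rightarrow> complex \<Rightarrow> complex \<Rightarrow> bool" where
  "theta_edge m P u v \<longleftrightarrow> u \<in> P \<and> v \<in> P \<and> v \<noteq> u \<and>
     (\<forall>w\<in>P. w \<noteq> u \<and> cone_idx m u w = cone_idx m u v \<longrightarrow>
        proj_len m (cone_idx m u v) u v \<le> proj_len m (cone_idx m u v) u w)"

definition theta_adj :: "nat \<Rightarrow> complex set \<Rightarrow> complex \<Rightarrow> complex \<Rightarrow> bool" where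
  "theta_adj m P x y \<longleftrightarrow> theta_edge m P x y \<or> theta_edge m P y x"

definition route_step :: "nat \<Rightarrow> complex set \<Rightarrow> complex \<Rightarrow> complex \<Rightarrow> complex \<Rightarrow> bool" where
  "route_step m P t x y \<longleftrightarrow>
     (theta_adj m P x t \<and> y = t) \<or>
     (\<not> theta_adj m P x t \<and> theta_edge m P x y \<and> cone_idx m x y = cone_idx m x t)"

definition routing_path :: "nat \<Rightarrow> complex set \<Rightarrow> complex \<Rightarrow> complex \<Rightarrow> complex list \<Rightarrow> bool" where
  "routing_path m P u t xs \<longleftrightarrow> xs \<noteq> [] \<and> hd xs = u \<and> last xs = t \<and>
     (\<forall>i < length xs - 1. xs ! i \<noteq> t \<and> route_step m P t (xs ! i) (xs ! Suc i))"

definition path_length :: "complex list \<Rightarrow> real" where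
  "path_length xs = (\<Sum>i < length xs - 1. dist (xs ! i) (xs ! Suc i))"

end

theory Submission
  imports Defs
begin

text \<open>Upper bound: write C and S for the cosine and sine of theta / 2. The potential of a vertex x is
  the l1 norm of t - x in the frame of the bisector of the cone of x containing t. As the number of
  cones is divisible by 4, that frame minimises the l1 norm of t - x over all bisector frames, so
  after a step from x to y the potential of y may be estimated in the old frame. If y - x has
  coordinates (h, s) there, h at most that of t, then the potential drops by at least
  h - |s|, which is at least (C - S) |xy|. Initially the potential is at most (C + S) |xt|.

  Lower bound: equality needs every step to run along the cone boundary opposite to the destination
  and to end at the foot of the perpendicular from the destination onto that boundary. The resulting
  path alternates between two cone directions, its distance to t shrinking geometrically. It is built from
  the destination outward, so errors of bounded size at each step are negligible compared with the
  exponentially growing distance, and each new point can be chosen off finitely many lines.\<close>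

section \<open>Cone coordinates\<close>

text \<open>Before the floor is taken, the value in \<open>cone_idx\<close> is the clockwise
  position of the direction, counted in cones. Its distance from the middle of cell \<open>i\<close>
  is the signed angle \<open>\<psi>\<close> to the bisector.\<close>

lemma cone_frame:
  assumes "m > 0" "u \<noteq> v"
  obtains \<psi> where "\<bar>\<psi>\<bar> \<le> cone_angle m / 2"
    "(v - u) * cnj (bisector m (cone_idx m u v)) = complex_of_real (dist u v) * cis \<psi>"
proof -
  define x where "x = (pi / 2 + cone_angle m / 2 - Arg (v - u)) / (2 * pi)"
  define y where "y = real m * frac x"
  define i where "i = cone_idx m u v"
  have y0: "0 \<le> y" unfolding y_def by simp
  have i: "i = nat \<lfloor>y\<rfloor>" unfolding i_def cone_idx_def y_def x_def ..
  then have iy: "real i \<le> y" "y < real i + 1" using y0 by linarith+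
  define \<psi> where "\<psi> = (1 / 2 - (y - real i)) * cone_angle m"
  have th: "cone_angle m > 0" using assms unfolding cone_angle_def by simp
  have "\<bar>1 / 2 - (y - real i)\<bar> \<le> 1 / 2" using iy by linarith
  then have "\<bar>\<psi>\<bar> \<le> cone_angle m / 2" unfolding \<psi>_def abs_mult using th
    by (metis abs_of_pos mult_right_mono less_imp_le mult.commute times_divide_eq_right mult_1_right)
  have yc: "y * cone_angle m = 2 * pi * (x - of_int \<lfloor>x\<rfloor>)"
    unfolding y_def cone_angle_def frac_def using assms by (simp add: field_simps)
  have "2 * pi * x = pi / 2 + cone_angle m / 2 - Arg (v - u)" unfolding x_def by simp
  \<comment> \<open>The whole turns discarded by \<open>frac\<close> reappear here and vanish under
    \<open>cis\<close>.\<close>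
  then have arg: "Arg (v - u) = \<psi> + (pi / 2 - real i * cone_angle m) - 2 * pi * of_int \<lfloor>x\<rfloor>"
    using yc unfolding \<psi>_def by (simp add: algebra_simps)
  have "v - u = complex_of_real (dist u v) * cis (Arg (v - u))"
    using rcis_cmod_Arg[of "v - u"] by (simp add: rcis_def dist_norm norm_minus_commute)
  also have "cis (Arg (v - u)) = cis \<psi> * bisector m i"
    unfolding arg bisector_def cis_mult by (simp add: cis_divide[symmetric])
  finally have "(v - u) * cnj (bisector m i)
      = complex_of_real (dist u v) * cis \<psi> * (bisector m i * cnj (bisector m i))" by simp
  also have "bisector m i * cnj (bisector m i) = 1" unfolding bisector_def by (simp add: cis_cnj cis_mult)
  finally show thesis using that \<open>\<bar>\<psi>\<bar> \<le> cone_angle m / 2\<close> i_def by simp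
qed

text \<open>Converse to \<open>cone_frame\<close>. The strict inequality forces a positive
  coordinate along the bisector and an angle strictly inside the cone, so the half-open boundary
  convention cannot affect the index.\<close>

lemma cone_idx_eqI:
  assumes "m > 2" "i < m" and w: "w = (v - u) * cnj (bisector m i)"
    and lt: "\<bar>Im w\<bar> < tan (cone_angle m / 2) * Re w"
  shows "cone_idx m u v = i"
proof -
  have th: "0 < cone_angle m" "cone_angle m / 2 < pi / 2"
    using assms unfolding cone_angle_def by (auto simp: field_simps)
  have t0: "tan (cone_angle m / 2) > 0" using th by (intro tan_gt_zero) auto
  have "tan (cone_angle m / 2) * Re w > 0" using lt by linarith
  then have re: "Re w > 0" using t0 zero_less_mult_pos by blast
  define \<psi> where "\<psi> = Arg w"
  have ps: "\<psi> = arctan (Im w / Re w)" unfolding \<psi>_def using re by (rule arg_conv_arctan)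
  have "Im w / Re w < tan (cone_angle m / 2)" "- tan (cone_angle m / 2) < Im w / Re w"
    using lt re by (auto simp: field_simps)
  then have "\<psi> < arctan (tan (cone_angle m / 2))" "arctan (- tan (cone_angle m / 2)) < \<psi>"
    unfolding ps arctan_less_iff by auto
  moreover have "arctan (tan (cone_angle m / 2)) = cone_angle m / 2"
    using th by (intro arctan_tan) auto
  ultimately have b: "\<psi> < cone_angle m / 2" "- (cone_angle m / 2) < \<psi>" by (auto simp: arctan_minus)
  have nz: "v - u \<noteq> 0" using re w by auto
  have "w * bisector m i = (v - u) * (bisector m i * cnj (bisector m i))" unfolding w by simp
  also have "bisector m i * cnj (bisector m i) = 1" unfolding bisector_def by (simp add: cis_cnj cis_mult)
  finally have vu: "v - u = w * bisector m i" by simp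
  have "complex_of_real (cmod w) * cis (Arg (v - u)) = v - u"
    using rcis_cmod_Arg[of "v - u"] vu by (simp add: rcis_def norm_mult bisector_def)
  also have "\<dots> = complex_of_real (cmod w) * cis \<psi> * bisector m i"
    using vu rcis_cmod_Arg[of w] by (simp add: rcis_def \<psi>_def)
  finally have "cis (Arg (v - u)) = cis (\<psi> + (pi / 2 - real i * cone_angle m))"
    using re unfolding bisector_def cis_mult mult.assoc by auto
  then have "\<exists>n::int. Arg (v - u) = \<psi> + (pi / 2 - real i * cone_angle m) + 2 * pi * n"
    unfolding sin_cos_eq_iff[symmetric] by (auto simp: complex_eq_iff)
  then obtain n :: int where n: "Arg (v - u) = \<psi> + (pi / 2 - real i * cone_angle m) + 2 * pi * n" ..
  \<comment> \<open>\<open>r\<close> is the position inside cone \<open>i\<close>, from 0 at its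
    counterclockwise boundary to 1 at its clockwise one.\<close>
  define r where "r = 1 / 2 - \<psi> / cone_angle m"
  have r: "0 < r" "r < 1" using b th unfolding r_def by (auto simp: field_simps)
  have im: "real i + r < real m" using r assms(2) by linarith
  have "(pi / 2 + cone_angle m / 2 - Arg (v - u)) / (2 * pi)
      = ((real i + r) * cone_angle m - 2 * pi * n) / (2 * pi)"
    unfolding n r_def using th by (simp add: field_simps)
  also have "\<dots> = (real i + r) / real m - n"
    using assms unfolding cone_angle_def by (simp add: field_simps)
  finally have eq: "(pi / 2 + cone_angle m / 2 - Arg (v - u)) / (2 * pi) = (real i + r) / real m - n" .
  have "frac ((real i + r) / real m - n) = (real i + r) / real m"
    unfolding frac_unique_iff using im r assms by (auto simp: field_simps)
  then have "cone_idx m u v = nat \<lfloor>real i + r\<rfloor>"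
    unfolding cone_idx_def eq using assms by simp
  moreover have "\<lfloor>real i + r\<rfloor> = int i" using r by (intro floor_unique) auto
  ultimately show ?thesis by simp
qed

section \<open>Trigonometry of half the cone angle for at least 8 cones\<close>

lemma half_cone_angle_bounds:
  assumes "m \<ge> 8"
  shows "0 < cone_angle m / 2" "cone_angle m / 2 \<le> pi / 8"
proof -
  show "0 < cone_angle m / 2" using assms by (simp add: cone_angle_def)
  have "pi * 8 \<le> pi * real m" using assms by simp
  then show "cone_angle m / 2 \<le> pi / 8" using assms by (simp add: cone_angle_def field_simps)
qed

text \<open>Since twice the angle is at most pi / 4, its sine is at most its cosine; the
  double-angle formulas then give \<open>2 * sin \<phi> < cos \<phi>\<close>. This keeps the final
  ratio finite, and its form \<open>2 * tan \<phi> < 1\<close> makes the zigzag grow.\<close>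

lemma half_cone_trig:
  assumes "m \<ge> 8"
  defines "\<phi> \<equiv> cone_angle m / 2"
  shows "0 < sin \<phi>" "2 * sin \<phi> < cos \<phi>" "sin \<phi> = tan \<phi> * cos \<phi>" "0 < cos \<phi>"
    "0 < tan \<phi>" "2 * tan \<phi> < 1"
proof -
  have b: "0 < \<phi>" "\<phi> \<le> pi / 8" using half_cone_angle_bounds[OF assms(1)] by (auto simp: \<phi>_def)
  show s: "0 < sin \<phi>" using b by (intro sin_gt_zero) auto
  show c: "0 < cos \<phi>" using b by (intro cos_gt_zero) auto
  have "sin (2 * \<phi>) \<le> sin (pi / 2 - 2 * \<phi>)" using b by (intro sin_monotone_2pi_le) auto
  also have "\<dots> = cos (2 * \<phi>)" using sin_cos_eq[of "pi/2 - 2 * \<phi>"] by (simp add: cos_sin_eq)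
  finally have "2 * sin \<phi> * cos \<phi> \<le> (cos \<phi>)\<^sup>2 - (sin \<phi>)\<^sup>2" by (simp add: sin_double cos_double)
  also have "\<dots> < cos \<phi> * cos \<phi>" using s by (simp add: power2_eq_square)
  finally show l: "2 * sin \<phi> < cos \<phi>" using c by simp
  show "sin \<phi> = tan \<phi> * cos \<phi>" using c by (simp add: tan_def)
  show "0 < tan \<phi>" "2 * tan \<phi> < 1" using s c l by (simp_all add: tan_def field_simps)
qed

text \<open>The first two bounds serve the potential; the third, free of the distance, states
  membership in the closed cone.\<close>

lemma cone_frame_bounds:
  assumes "m \<ge> 8" "u \<noteq> v"
  defines "w \<equiv> (v - u) * cnj (bisector m (cone_idx m u v))"
  shows "\<bar>Im w\<bar> \<le> sin (cone_angle m / 2) * dist u v"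
    "cos (cone_angle m / 2) * dist u v \<le> Re w"
    "\<bar>Im w\<bar> \<le> tan (cone_angle m / 2) * Re w"
proof -
  obtain \<psi> where ps: "\<bar>\<psi>\<bar> \<le> cone_angle m / 2"
    and w: "w = complex_of_real (dist u v) * cis \<psi>"
    using cone_frame[of m u v] assms unfolding w_def by auto
  note b = half_cone_angle_bounds[OF assms(1)]
  have "sin \<bar>\<psi>\<bar> \<le> sin (cone_angle m / 2)" using ps b by (intro sin_monotone_2pi_le) auto
  moreover have "\<bar>sin \<psi>\<bar> = sin \<bar>\<psi>\<bar>"
    using ps b sin_ge_zero[of "\<bar>\<psi>\<bar>"] by (cases "\<psi> \<ge> 0") (auto simp: abs_if)
  ultimately have s: "\<bar>sin \<psi>\<bar> \<le> sin (cone_angle m / 2)" by simp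
  have c: "cos (cone_angle m / 2) \<le> cos \<psi>"
    using ps b cos_monotone_0_pi_le[of "\<bar>\<psi>\<bar>" "cone_angle m / 2"] by simp
  show 1: "\<bar>Im w\<bar> \<le> sin (cone_angle m / 2) * dist u v"
    unfolding w using mult_left_mono[OF s, of "dist u v"] by (simp add: abs_mult mult.commute)
  show 2: "cos (cone_angle m / 2) * dist u v \<le> Re w"
    unfolding w using mult_left_mono[OF c, of "dist u v"] by (simp add: mult.commute)
  have "sin (cone_angle m / 2) * dist u v = tan (cone_angle m / 2) * (cos (cone_angle m / 2) * dist u v)"
    using half_cone_trig(3)[OF assms(1)] by simp
  also have "\<dots> \<le> tan (cone_angle m / 2) * Re w"
    using 2 half_cone_trig(5)[OF assms(1)] by (intro mult_left_mono) auto
  finally show "\<bar>Im w\<bar> \<le> tan (cone_angle m / 2) * Re w" using 1 by linarith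
qed

section \<open>The potential and the upper bound\<close>

definition l1 :: "complex \<Rightarrow> real" where
  "l1 z = \<bar>Re z\<bar> + \<bar>Im z\<bar>"

definition route_potential :: "nat \<Rightarrow> complex \<Rightarrow> complex \<Rightarrow> real" where
  "route_potential m t x = l1 ((t - x) * cnj (bisector m (cone_idx m x t)))"

text \<open>Rotation preserves the modulus, so comparing l1 norms across frames amounts to comparing
  the products of the coordinates.\<close>

lemma l1_power2: "(l1 z)\<^sup>2 = (cmod z)\<^sup>2 + 2 * \<bar>Re z * Im z\<bar>"
  unfolding l1_def cmod_power2 by (simp add: power2_sum abs_mult)

lemma cmod_le_l1: "cmod z \<le> l1 z"
  unfolding l1_def by (rule cmod_le)

text \<open>As |sin| has period pi, only shifts by \<open>r\<close> with 0 \<le> \<open>r\<close> <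
  \<open>K\<close> matter. A nonzero one moves \<open>y\<close> into the interval from \<beta> to pi
  - \<beta>, with \<beta> = pi / (2 K), where sin is at least sin \<beta> \<ge> |sin y|.\<close>

lemma abs_sin_add_period_ge:
  assumes "K > 0" "\<bar>y\<bar> \<le> pi / (2 * real K)"
  shows "\<bar>sin y\<bar> \<le> \<bar>sin (y + of_int j * pi / real K)\<bar>"
proof -
  define q r where "q = j div int K" and "r = j mod int K"
  have j: "j = q * int K + r" and r: "0 \<le> r" "r < int K"
    using assms by (auto simp: q_def r_def)
  have "y + of_int j * pi / real K = (y + of_int r * pi / real K) + of_int q * pi"
    unfolding j using assms by (simp add: field_simps)
  then have eq: "\<bar>sin (y + of_int j * pi / real K)\<bar> = \<bar>sin (y + of_int r * pi / real K)\<bar>"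
    by (simp only: sin_add[of _ "of_int q * pi"]) (auto simp: mult.commute)
  define \<beta> where "\<beta> = pi / (2 * real K)"
  have b: "0 < \<beta>" "\<beta> \<le> pi / 2" using assms by (auto simp: \<beta>_def field_simps)
  show ?thesis
  proof (cases "r = 0")
    case True
    then show ?thesis unfolding eq by simp
  next
    case False
    define z where "z = y + of_int r * pi / real K"
    have rb: "of_int r * pi / real K = 2 * of_int r * \<beta>" "pi = 2 * real K * \<beta>"
      using assms by (auto simp: \<beta>_def field_simps)
    have "1 * \<beta> \<le> real_of_int r * \<beta>" using r False b by (intro mult_right_mono) auto
    moreover have "real_of_int r \<le> real K - 1" using r by linarith
    then have "real_of_int r * \<beta> \<le> (real K - 1) * \<beta>" using b by (intro mult_right_mono) auto
    ultimately have z: "\<beta> \<le> z" "z \<le> pi - \<beta>"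
      using assms(2) unfolding z_def rb(1) \<beta>_def[symmetric] by (auto simp: rb(2) algebra_simps)
    have "sin \<beta> \<le> sin z"
    proof (cases "z \<le> pi / 2")
      case True
      then show ?thesis using z b by (intro sin_monotone_2pi_le) auto
    next
      case False
      then have "sin \<beta> \<le> sin (pi - z)" using z b by (intro sin_monotone_2pi_le) auto
      then show ?thesis by simp
    qed
    moreover have "\<bar>sin y\<bar> \<le> sin \<beta>"
    proof -
      have y: "- \<beta> \<le> y" "y \<le> \<beta>" using assms(2) unfolding \<beta>_def by linarith+
      have "sin (- \<beta>) \<le> sin y" by (rule sin_monotone_2pi_le) (use y b in auto)
      moreover have "sin y \<le> sin \<beta>" by (rule sin_monotone_2pi_le) (use y b in auto)
      ultimately show ?thesis by simp
    qed
    ultimately show ?thesis unfolding eq z_def by linarith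
  qed
qed

text \<open>Rotating the frame by j theta turns the product of the coordinates into
  sin (2 psi + 2 j theta) / 2, where 2 theta = pi / (k + 1) since the number of cones is
  divisible by 4.\<close>
lemma route_potential_le:
  "route_potential (4 * k + 4) t x \<le> l1 ((t - x) * cnj (bisector (4 * k + 4) i))"
proof (cases "x = t")
  case False
  define m where "m = 4 * k + 4"
  define d where "d = cone_idx m x t"
  define w where "w = (t - x) * cnj (bisector m d)"
  define w' where "w' = (t - x) * cnj (bisector m i)"
  obtain \<psi> where ps: "\<bar>\<psi>\<bar> \<le> cone_angle m / 2" and w: "w = complex_of_real (dist x t) * cis \<psi>"
    using cone_frame[of m x t] False unfolding w_def d_def m_def by auto
  define j where "j = int i - int d"
  have 1: "bisector m d * cnj (bisector m d) = 1" unfolding bisector_def by (simp add: cis_cnj cis_mult)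
  have "t - x = w * bisector m d" unfolding w_def using 1 by (simp add: mult.assoc mult.commute)
  then have "w' = complex_of_real (dist x t) * (cis \<psi> * (bisector m d * cnj (bisector m i)))"
    unfolding w'_def w by simp
  also have "cis \<psi> * (bisector m d * cnj (bisector m i)) = cis (\<psi> + of_int j * cone_angle m)"
    unfolding bisector_def by (simp add: cis_cnj cis_mult j_def algebra_simps)
  finally have w': "w' = complex_of_real (dist x t) * cis (\<psi> + of_int j * cone_angle m)" .
  have th: "cone_angle m = pi / (2 * real (k + 1))" unfolding cone_angle_def m_def by (simp add: field_simps)
  have "\<bar>sin (2 * \<psi>)\<bar> \<le> \<bar>sin (2 * \<psi> + of_int j * pi / real (k + 1))\<bar>"
    using ps by (intro abs_sin_add_period_ge) (auto simp: th abs_mult field_simps)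
  also have "2 * \<psi> + of_int j * pi / real (k + 1) = 2 * (\<psi> + of_int j * cone_angle m)"
    unfolding th by (simp add: field_simps)
  finally have "\<bar>sin (2 * \<psi>)\<bar> \<le> \<bar>sin (2 * (\<psi> + of_int j * cone_angle m))\<bar>" .
  moreover have rc: "\<bar>Re (cis a) * Im (cis a)\<bar> = \<bar>sin (2 * a)\<bar> / 2" for a
    by (simp only: sin_double) (simp add: abs_mult)
  ultimately have "\<bar>Re (cis \<psi>) * Im (cis \<psi>)\<bar> \<le> \<bar>Re (cis (\<psi> + of_int j * cone_angle m)) * Im (cis (\<psi> + of_int j * cone_angle m))\<bar>"
    unfolding rc by simp
  then have "(dist x t)\<^sup>2 * \<bar>Re (cis \<psi>) * Im (cis \<psi>)\<bar>
      \<le> (dist x t)\<^sup>2 * \<bar>Re (cis (\<psi> + of_int j * cone_angle m)) * Im (cis (\<psi> + of_int j * cone_angle m))\<bar>"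
    by (intro mult_left_mono) auto
  then have "\<bar>Re w * Im w\<bar> \<le> \<bar>Re w' * Im w'\<bar>"
    unfolding w w' by (simp add: abs_mult power2_eq_square mult_ac)
  then have "(l1 w)\<^sup>2 \<le> (l1 w')\<^sup>2"
    unfolding l1_power2 by (simp add: w w' norm_mult)
  then have "l1 w \<le> l1 w'" by (rule power2_le_imp_le) (simp add: l1_def)
  then show ?thesis unfolding route_potential_def w_def w'_def d_def m_def .
qed (simp add: route_potential_def l1_def)

text \<open>The lower bound pays for a direct edge to the destination; the upper one bounds the
  initial potential.\<close>

lemma route_potential_bounds:
  assumes "m \<ge> 8"
  shows "dist x t \<le> route_potential m t x"
    "route_potential m t x \<le> (cos (cone_angle m / 2) + sin (cone_angle m / 2)) * dist x t"
proof -
  define w where "w = (t - x) * cnj (bisector m (cone_idx m x t))"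
  have n: "cmod w = dist x t" unfolding w_def bisector_def by (simp add: norm_mult dist_norm norm_minus_commute)
  show "dist x t \<le> route_potential m t x"
    using cmod_le_l1[of w] n unfolding route_potential_def w_def by simp
  define \<phi> where "\<phi> = cone_angle m / 2"
  show "route_potential m t x \<le> (cos (cone_angle m / 2) + sin (cone_angle m / 2)) * dist x t"
  proof (cases "x = t")
    case False
    note b = cone_frame_bounds[OF assms False, folded w_def \<phi>_def]
    note t = half_cone_trig[OF assms, folded \<phi>_def]
    define D where "D = dist x t"
    define X Y where "X = \<bar>Re w\<bar>" and "Y = \<bar>Im w\<bar>"
    have D: "X\<^sup>2 + Y\<^sup>2 = D\<^sup>2" unfolding X_def Y_def D_def n[symmetric] by (simp add: cmod_power2)
    have sc: "(cos \<phi>)\<^sup>2 + (sin \<phi>)\<^sup>2 = 1" by simp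
    have bX: "cos \<phi> * D \<le> X" and bY: "Y \<le> sin \<phi> * D" using b unfolding X_def Y_def D_def by auto
    have "X \<ge> 0" "Y \<ge> 0" "D \<ge> 0" by (auto simp: X_def Y_def D_def)
    text \<open>Among unit vectors near an axis the l1 norm grows with the angle, so the
      extreme case is the boundary ray; the chord inequality X - C D <= S D - Y expresses this.\<close>
    have "(X - cos \<phi> * D) * (X + cos \<phi> * D) = (sin \<phi> * D - Y) * (sin \<phi> * D + Y)"
    proof -
      have "D\<^sup>2 = (cos \<phi>)\<^sup>2 * D\<^sup>2 + (sin \<phi>)\<^sup>2 * D\<^sup>2" using sc by (metis distrib_right mult_1)
      then show ?thesis using D by (simp add: algebra_simps power2_eq_square)
    qed
    also have "\<dots> \<le> (sin \<phi> * D - Y) * (X + cos \<phi> * D)"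
    proof (rule mult_left_mono)
      have "sin \<phi> * D \<le> cos \<phi> * D" using t \<open>D \<ge> 0\<close> by (intro mult_right_mono) auto
      then show "sin \<phi> * D + Y \<le> X + cos \<phi> * D" using bX bY by linarith
    qed (use bY in simp)
    finally have "X - cos \<phi> * D \<le> sin \<phi> * D - Y"
    proof (rule mult_right_le_imp_le)
      have "D > 0" using False by (simp add: D_def)
      then have "cos \<phi> * D > 0" using t by simp
      then show "X + cos \<phi> * D > 0" using \<open>X \<ge> 0\<close> by simp
    qed
    then show ?thesis unfolding route_potential_def w_def[symmetric] l1_def
        X_def[symmetric] Y_def[symmetric] D_def[symmetric] \<phi>_def[symmetric] by (simp add: algebra_simps)
  qed (simp add: route_potential_def l1_def)
qed

lemma route_step_in: "route_step m P t x y \<Longrightarrow> t \<in> P \<Longrightarrow> y \<in> P"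
  unfolding route_step_def theta_edge_def by auto

lemma route_step_potential:
  assumes m: "m = 4 * k + 4" "k \<ge> 1" and "t \<in> P" "x \<noteq> t" and step: "route_step m P t x y"
  shows "(cos (cone_angle m / 2) - sin (cone_angle m / 2)) * dist x y + route_potential m t y
    \<le> route_potential m t x"
proof -
  have m8: "m \<ge> 8" using m by simp
  define \<phi> where "\<phi> = cone_angle m / 2"
  note t = half_cone_trig[OF m8, folded \<phi>_def]
  show ?thesis
  proof (cases "theta_adj m P x t")
    case True
    then have "y = t" using step by (simp add: route_step_def)
    have "cos \<phi> - sin \<phi> \<le> 1" using t cos_le_one[of \<phi>] by linarith
    then have "(cos \<phi> - sin \<phi>) * dist x t \<le> 1 * dist x t" by (intro mult_right_mono) auto
    also have "\<dots> \<le> route_potential m t x" using route_potential_bounds(1)[OF m8] by simp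
    \<comment> \<open>The potential at \<open>t\<close> is 0 whatever index \<open>cone_idx\<close>
      gives to the zero vector.\<close>
    finally show ?thesis unfolding \<open>y = t\<close> \<phi>_def by (simp add: route_potential_def l1_def)
  next
    case False
    define i where "i = cone_idx m x t"
    have e: "theta_edge m P x y" and i: "cone_idx m x y = i"
      using step False by (auto simp: route_step_def i_def)
    then have xy: "x \<noteq> y" by (auto simp: theta_edge_def)
    define v where "v = (y - x) * cnj (bisector m i)"
    define T where "T = (t - x) * cnj (bisector m i)"
    have le: "Re v \<le> Re T"
      using e i \<open>t \<in> P\<close> \<open>x \<noteq> t\<close> unfolding theta_edge_def proj_len_def v_def T_def i_def by auto
    note vb = cone_frame_bounds[OF m8 xy, unfolded i, folded v_def \<phi>_def]
    have "cos \<phi> * dist x y \<ge> 0" using t by simp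
    then have v0: "0 \<le> Re v" using vb(2) by linarith
    have "route_potential m t y \<le> l1 ((t - y) * cnj (bisector m i))"
      unfolding m(1) by (rule route_potential_le)
    also have "(t - y) * cnj (bisector m i) = T - v" unfolding T_def v_def by (simp add: algebra_simps)
    \<comment> \<open>No overshoot occurs along the bisector, so that coordinate shrinks by exactly
      \<open>Re v\<close>; across it the triangle inequality loses at most
      \<open>\<bar>Im v\<bar>\<close>.\<close>
    also have "l1 (T - v) \<le> l1 T - (Re v - \<bar>Im v\<bar>)" unfolding l1_def using le v0 by simp
    also have "l1 T = route_potential m t x" unfolding route_potential_def T_def i_def ..
    finally show ?thesis using vb unfolding \<phi>_def[symmetric] by (simp add: algebra_simps)
  qed
qed

section \<open>Recursion for paths, termination and the routing ratio\<close>

lemma routing_path_single: "routing_path m P u t [x] \<longleftrightarrow> x = u \<and> u = t"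
  unfolding routing_path_def by auto

lemma routing_path_Cons_Cons:
  "routing_path m P u t (x # y # ys) \<longleftrightarrow>
    x = u \<and> u \<noteq> t \<and> route_step m P t u y \<and> routing_path m P y t (y # ys)"
proof -
  have "(\<forall>i < length (x # y # ys) - 1. (x # y # ys) ! i \<noteq> t \<and> route_step m P t ((x # y # ys) ! i) ((x # y # ys) ! Suc i))
    \<longleftrightarrow> x \<noteq> t \<and> route_step m P t x y \<and>
      (\<forall>i < length (y # ys) - 1. (y # ys) ! i \<noteq> t \<and> route_step m P t ((y # ys) ! i) ((y # ys) ! Suc i))"
    by (auto simp: less_Suc_eq_0_disj)
  then show ?thesis unfolding routing_path_def by auto
qed

lemma path_length_single: "path_length [x] = 0"
  unfolding path_length_def by simp

lemma path_length_Cons_Cons: "path_length (x # y # ys) = dist x y + path_length (y # ys)"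
  unfolding path_length_def by (simp add: sum.lessThan_Suc_shift del: sum.lessThan_Suc)

lemma path_length_nonneg: "0 \<le> path_length xs"
  unfolding path_length_def by (intro sum_nonneg) auto

lemma routing_path_Cons:
  assumes "u \<noteq> t" "route_step m P t u y" "routing_path m P y t xs"
  shows "routing_path m P u t (u # xs)" "path_length (u # xs) = dist u y + path_length xs"
proof -
  obtain ys where "xs = y # ys" using assms(3) by (cases xs) (auto simp: routing_path_def)
  then show "routing_path m P u t (u # xs)" "path_length (u # xs) = dist u y + path_length xs"
    using assms by (auto simp: routing_path_Cons_Cons path_length_Cons_Cons)
qed

text \<open>The one-step drops telescope, and the potential ends at 0.\<close>

lemma routing_path_length_le:
  assumes m: "m = 4 * k + 4" "k \<ge> 1" and "t \<in> P" "routing_path m P u t xs"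
  shows "(cos (cone_angle m / 2) - sin (cone_angle m / 2)) * path_length xs \<le> route_potential m t u"
  using assms(4)
proof (induction xs arbitrary: u rule: induct_list012)
  case 1
  then show ?case by (simp add: routing_path_def)
next
  case (2 x)
  then show ?case by (simp add: path_length_single route_potential_def l1_def)
next
  case (3 x y ys)
  then have p: "x = u" "u \<noteq> t" "route_step m P t u y" "routing_path m P y t (y # ys)"
    by (auto simp: routing_path_Cons_Cons)
  have "(cos (cone_angle m / 2) - sin (cone_angle m / 2)) * path_length (y # ys) \<le> route_potential m t y"
    using 3 p by blast
  then show ?case using route_step_potential[OF m \<open>t \<in> P\<close> p(2,3)] p(1)
    by (simp add: path_length_Cons_Cons algebra_simps)
qed

lemma route_step_exists:
  assumes "finite P" "x \<in> P" "t \<in> P" "x \<noteq> t"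
  obtains y where "route_step m P t x y" "y \<noteq> x"
proof (cases "theta_adj m P x t")
  case True
  then show ?thesis using that[of t] assms by (auto simp: route_step_def)
next
  case False
  define i where "i = cone_idx m x t"
  define Q where "Q = {w \<in> P. w \<noteq> x \<and> cone_idx m x w = i}"
  \<comment> \<open>The destination itself lies in \<open>Q\<close>.\<close>
  have Q: "finite Q" "Q \<noteq> {}" using assms by (auto simp: Q_def i_def)
  define y where "y = arg_min_on (proj_len m i x) Q"
  have y: "y \<in> Q" "\<And>w. w \<in> Q \<Longrightarrow> proj_len m i x y \<le> proj_len m i x w"
    unfolding y_def using arg_min_if_finite(1)[OF Q] arg_min_least[OF Q] by auto
  have "theta_edge m P x y"
    using y assms(2) unfolding theta_edge_def Q_def by auto
  then show ?thesis using that[of y] False y(1) unfolding route_step_def Q_def i_def by auto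
qed

text \<open>Each step strictly lowers the potential, so the number of points of smaller potential is
  a termination measure.\<close>

lemma routing_path_exists:
  assumes m: "m = 4 * k + 4" "k \<ge> 1" and "finite P" "u \<in> P" "t \<in> P"
  shows "\<exists>xs. routing_path m P u t xs"
  using assms(4)
proof (induction "card {p \<in> P. route_potential m t p < route_potential m t u}" arbitrary: u rule: less_induct)
  case less
  show ?case
  proof (cases "u = t")
    case True
    then show ?thesis using routing_path_single by blast
  next
    case False
    obtain y where y: "route_step m P t u y" "y \<noteq> u"
      using route_step_exists[OF \<open>finite P\<close> \<open>u \<in> P\<close> \<open>t \<in> P\<close> False] by blast
    have yP: "y \<in> P" using y(1) \<open>t \<in> P\<close> by (rule route_step_in)
    have "0 < (cos (cone_angle m / 2) - sin (cone_angle m / 2)) * dist u y"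
      using half_cone_trig[of m] m y(2) by (intro mult_pos_pos) auto
    then have lt: "route_potential m t y < route_potential m t u"
      using route_step_potential[OF m \<open>t \<in> P\<close> False y(1)] by linarith
    then have "{p \<in> P. route_potential m t p < route_potential m t y} \<subset> {p \<in> P. route_potential m t p < route_potential m t u}"
      using yP by auto
    then have "card {p \<in> P. route_potential m t p < route_potential m t y} < card {p \<in> P. route_potential m t p < route_potential m t u}"
      using \<open>finite P\<close> by (intro psubset_card_mono) auto
    then obtain xs where "routing_path m P y t xs" using less yP by blast
    then show ?thesis using routing_path_Cons(1)[OF False y(1)] by blast
  qed
qed

lemma routing_ratio_upper:
  assumes m: "m = 4 * k + 4" "k \<ge> 1" and "t \<in> P" "routing_path m P u t xs"
  defines "\<phi> \<equiv> cone_angle m / 2"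
  shows "path_length xs \<le> (1 + 2 * sin \<phi> / (cos \<phi> - sin \<phi>)) * dist u t"
proof -
  have m8: "m \<ge> 8" using m by simp
  note t = half_cone_trig[OF m8, folded \<phi>_def]
  have pos: "cos \<phi> - sin \<phi> > 0" using t by simp
  have "(cos \<phi> - sin \<phi>) * path_length xs \<le> (cos \<phi> + sin \<phi>) * dist u t"
    using routing_path_length_le[OF m assms(3,4)] route_potential_bounds(2)[OF m8, of t u]
    unfolding \<phi>_def by linarith
  then have "path_length xs \<le> (cos \<phi> + sin \<phi>) / (cos \<phi> - sin \<phi>) * dist u t"
    using pos by (simp add: field_simps)
  also have "(cos \<phi> + sin \<phi>) / (cos \<phi> - sin \<phi>) = 1 + 2 * sin \<phi> / (cos \<phi> - sin \<phi>)"
    using pos by (simp add: field_simps)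
  finally show ?thesis .
qed

section \<open>Points in general position\<close>

text \<open>Finitely many hyperplanes form a null set, which cannot cover a nonempty open
  set.\<close>

lemma exists_avoiding_hyperplanes:
  fixes U :: "'a::euclidean_space set"
  assumes "open U" "U \<noteq> {}" "finite H" "0 \<notin> H" "finite Q"
  obtains p where "p \<in> U" "\<And>a q. a \<in> H \<Longrightarrow> q \<in> Q \<Longrightarrow> a \<bullet> p \<noteq> a \<bullet> q"
proof -
  have "negligible (\<Union>(a, q)\<in>H \<times> Q. {p. a \<bullet> p = a \<bullet> q})"
    using assms by (intro negligible_Union) (auto intro!: negligible_hyperplane)
  then have "\<not> U \<subseteq> (\<Union>(a, q)\<in>H \<times> Q. {p. a \<bullet> p = a \<bullet> q})"
    using open_not_negligible[OF assms(1,2)] negligible_subset by blast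
  then show ?thesis using that by blast
qed

text \<open>\<open>\<i> * (r - q)\<close> is normal to the line through \<open>q\<close> and
  \<open>r\<close>, so collinearity takes the same form as the other forbidden lines.\<close>

lemma collinear_imp_inner_eq:
  assumes "collinear {p, q, r}" "q \<noteq> r"
  shows "(\<i> * (r - q)) \<bullet> p = (\<i> * (r - q)) \<bullet> q"
proof -
  have "collinear {q, p, r}" using assms(1) by (simp add: insert_commute)
  then obtain u where "p = u *\<^sub>R q + (1 - u) *\<^sub>R r" using assms(2) by (auto simp: collinear_3_expand)
  then have e: "Re p = u * Re q + (1 - u) * Re r" "Im p = u * Im q + (1 - u) * Im r" by simp_all
  show ?thesis unfolding inner_complex_def e by (simp add: algebra_simps)
qed

text \<open>Every way a new point can violate general position places it on a line through an old
  point with one of three kinds of normal.\<close>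

lemma general_position_insert:
  assumes gp: "general_position m Q"
    and bd: "\<And>j q. j < m \<Longrightarrow> q \<in> Q \<Longrightarrow> (\<i> * boundary_dir m j) \<bullet> p \<noteq> (\<i> * boundary_dir m j) \<bullet> q"
    and bi: "\<And>i q. i < m \<Longrightarrow> q \<in> Q \<Longrightarrow> bisector m i \<bullet> p \<noteq> bisector m i \<bullet> q"
    and co: "\<And>q r. q \<in> Q \<Longrightarrow> r \<in> Q \<Longrightarrow> q \<noteq> r \<Longrightarrow> (\<i> * (r - q)) \<bullet> p \<noteq> (\<i> * (r - q)) \<bullet> q"
  shows "general_position m (insert p Q)"
proof -
  have 1: "q - p \<noteq> complex_of_real r * boundary_dir m j" "p - q \<noteq> complex_of_real r * boundary_dir m j"
    if "j < m" "q \<in> Q" for j q r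
  proof -
    have "(\<i> * boundary_dir m j) \<bullet> (complex_of_real r * boundary_dir m j) = 0"
      by (simp add: inner_complex_def)
    then show "q - p \<noteq> complex_of_real r * boundary_dir m j" "p - q \<noteq> complex_of_real r * boundary_dir m j"
      using bd[OF that] by (metis inner_diff_right eq_iff_diff_eq_0)+
  qed
  have 2: "Re ((q - p) * cnj (bisector m i)) \<noteq> 0" "Re ((p - q) * cnj (bisector m i)) \<noteq> 0"
    if "i < m" "q \<in> Q" for i q
    using bi[OF that] by (auto simp: inner_complex_def algebra_simps)
  have 3: "\<not> collinear {p, q, r}" if "q \<in> Q" "r \<in> Q" "q \<noteq> r" for q r
    using collinear_imp_inner_eq[of p q r] co[OF that] that(3) by blast
  have 4: "\<not> collinear {q, p, r}" "\<not> collinear {q, r, p}" if "q \<in> Q" "r \<in> Q" "q \<noteq> r" for q r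
  proof -
    have "{q, p, r} = {p, q, r}" "{q, r, p} = {p, q, r}" by auto
    then show "\<not> collinear {q, p, r}" "\<not> collinear {q, r, p}" using 3[OF that] by simp_all
  qed
  show ?thesis
    unfolding general_position_def
  proof (intro conjI ballI impI)
    fix x y assume xy: "x \<in> insert p Q" "y \<in> insert p Q" "x \<noteq> y"
    show "\<forall>j<m. \<forall>r. y - x \<noteq> complex_of_real r * boundary_dir m j"
      using xy 1 gp unfolding general_position_def by blast
    show "\<forall>i<m. Re ((y - x) * cnj (bisector m i)) \<noteq> 0"
      using xy 2 gp unfolding general_position_def by blast
  next
    fix x y z assume "x \<in> insert p Q" "y \<in> insert p Q" "z \<in> insert p Q" "x \<noteq> y \<and> y \<noteq> z \<and> x \<noteq> z"
    then consider "x = p" "y \<in> Q" "z \<in> Q" | "y = p" "x \<in> Q" "z \<in> Q" | "z = p" "x \<in> Q" "y \<in> Q"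
      | "x \<in> Q" "y \<in> Q" "z \<in> Q" by blast
    then show "\<not> collinear {x, y, z}"
      using 3 4 gp \<open>x \<noteq> y \<and> y \<noteq> z \<and> x \<noteq> z\<close> unfolding general_position_def by cases auto
  qed
qed

lemma general_position_extend:
  assumes "open U" "U \<noteq> {}" "finite Q" "general_position m Q"
  obtains p where "p \<in> U" "general_position m (insert p Q)"
proof -
  define H where "H = (\<lambda>j. \<i> * boundary_dir m j) ` {..<m} \<union> bisector m ` {..<m}
    \<union> (\<lambda>(q, r). \<i> * (r - q)) ` {(q, r) \<in> Q \<times> Q. q \<noteq> r}"
  have "{(q, r) \<in> Q \<times> Q. q \<noteq> r} \<subseteq> Q \<times> Q" by auto
  then have "finite {(q, r) \<in> Q \<times> Q. q \<noteq> r}" using assms(3) finite_subset by blast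
  then have "finite H" unfolding H_def by auto
  moreover have "0 \<notin> H" unfolding H_def boundary_dir_def bisector_def by auto
  ultimately obtain p where p: "p \<in> U" "\<And>a q. a \<in> H \<Longrightarrow> q \<in> Q \<Longrightarrow> a \<bullet> p \<noteq> a \<bullet> q"
    using exists_avoiding_hyperplanes[OF assms(1,2) _ _ assms(3)] by blast
  have "general_position m (insert p Q)"
    by (rule general_position_insert[OF assms(4)]) (rule p(2); force simp: H_def)+
  then show ?thesis using that p(1) by blast
qed

lemma general_position_singleton: "general_position m {p}"
  unfolding general_position_def by auto

section \<open>The zigzag construction\<close>

text \<open>Points of even index approach the destination 0 through their upward cone, points of odd
  index through their rightward cone; lo and hi are the coordinates across and along the bisector
  of that cone.\<close>

definition lo :: "nat \<Rightarrow> complex \<Rightarrow> real" where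
  "lo n z = (if even n then - Re z else - Im z)"

definition hi :: "nat \<Rightarrow> complex \<Rightarrow> real" where
  "hi n z = (if even n then - Im z else - Re z)"

definition cone_toward :: "nat \<Rightarrow> nat \<Rightarrow> nat" where
  "cone_toward k n = (if even n then 0 else k + 1)"

text \<open>The opposite cone, half a turn away: the one in which the destination sees the
  point.\<close>

definition cone_away :: "nat \<Rightarrow> nat \<Rightarrow> nat" where
  "cone_away k n = (if even n then 2 * k + 2 else 3 * k + 3)"

text \<open>A quarter turn is exactly \<open>k + 1\<close> cones.\<close>

lemma quarter_bisectors:
  "bisector (4 * k + 4) 0 = \<i>" "bisector (4 * k + 4) (k + 1) = 1"
  "bisector (4 * k + 4) (2 * k + 2) = - \<i>" "bisector (4 * k + 4) (3 * k + 3) = - 1"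
proof -
  have a: "real (l * (k + 1)) * cone_angle (4 * k + 4) = real l * (pi / 2)" for l
    unfolding cone_angle_def by (simp add: field_simps)
  have "bisector (4 * k + 4) (l * (k + 1)) = cis (pi / 2 - real l * (pi / 2))" for l
    unfolding bisector_def a ..
  from this[of 0] this[of 1] this[of 2] this[of 3]
  show "bisector (4 * k + 4) 0 = \<i>" "bisector (4 * k + 4) (k + 1) = 1"
    "bisector (4 * k + 4) (2 * k + 2) = - \<i>" "bisector (4 * k + 4) (3 * k + 3) = - 1"
    by (simp_all add: complex_eq_iff algebra_simps cis_pi)
qed

text \<open>The sign of the transverse coordinate depends on the parity, hence the absolute
  values.\<close>

lemma frame_toward:
  "Re (z * cnj (bisector (4 * k + 4) (cone_toward k n))) = - hi n z"
  "\<bar>Im (z * cnj (bisector (4 * k + 4) (cone_toward k n)))\<bar> = \<bar>lo n z\<bar>"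
  unfolding cone_toward_def hi_def lo_def using quarter_bisectors[of k] by auto

lemma frame_away:
  "Re (z * cnj (bisector (4 * k + 4) (cone_away k n))) = hi n z"
  "\<bar>Im (z * cnj (bisector (4 * k + 4) (cone_away k n)))\<bar> = \<bar>lo n z\<bar>"
  unfolding cone_away_def hi_def lo_def using quarter_bisectors[of k] by auto

lemma lo_hi_diff: "lo n (x - y) = lo n x - lo n y" "hi n (x - y) = hi n x - hi n y"
  unfolding lo_def hi_def by auto

text \<open>Passing to a neighbouring index exchanges the two coordinates.\<close>

lemma lo_hi_parity:
  "even i = even j \<Longrightarrow> lo i z = lo j z" "even i = even j \<Longrightarrow> hi i z = hi j z"
  "even i \<noteq> even j \<Longrightarrow> lo i z = hi j z" "even i \<noteq> even j \<Longrightarrow> hi i z = lo j z"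
  unfolding lo_def hi_def by auto

lemma lo_hi_0: "lo n 0 = 0" "hi n 0 = 0"
  unfolding lo_def hi_def by auto

lemma cmod_lo_hi: "(cmod z)\<^sup>2 = (lo n z)\<^sup>2 + (hi n z)\<^sup>2"
  unfolding lo_def hi_def cmod_power2 by auto

lemma proj_len_toward: "proj_len (4 * k + 4) (cone_toward k n) u v = hi n u - hi n v"
  unfolding proj_len_def frame_toward lo_hi_diff by simp

lemma proj_len_away: "proj_len (4 * k + 4) (cone_away k n) u v = hi n v - hi n u"
  unfolding proj_len_def frame_away lo_hi_diff by simp

section \<open>Cone membership in zigzag coordinates\<close>

context
  fixes k m :: nat and \<tau> :: real
  assumes k: "k \<ge> 1" and m: "m = 4 * k + 4" and \<tau>: "\<tau> = tan (cone_angle m / 2)"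
begin

lemma cone_idx_toward:
  assumes "\<bar>lo n u - lo n v\<bar> < \<tau> * (hi n u - hi n v)"
  shows "cone_idx m u v = cone_toward k n"
proof (rule cone_idx_eqI[OF _ _ refl])
  show "2 < m" "cone_toward k n < m" using k m by (auto simp: cone_toward_def)
  show "\<bar>Im ((v - u) * cnj (bisector m (cone_toward k n)))\<bar>
      < tan (cone_angle m / 2) * Re ((v - u) * cnj (bisector m (cone_toward k n)))"
    using assms unfolding m frame_toward lo_hi_diff by (simp add: \<tau> m algebra_simps abs_minus_commute)
qed

lemma cone_idx_away:
  assumes "\<bar>lo n v - lo n u\<bar> < \<tau> * (hi n v - hi n u)"
  shows "cone_idx m u v = cone_away k n"
proof (rule cone_idx_eqI[OF _ _ refl])
  show "2 < m" "cone_away k n < m" using k m by (auto simp: cone_away_def)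
  show "\<bar>Im ((v - u) * cnj (bisector m (cone_away k n)))\<bar>
      < tan (cone_angle m / 2) * Re ((v - u) * cnj (bisector m (cone_away k n)))"
    using assms unfolding m frame_away lo_hi_diff by (simp add: \<tau> m)
qed

lemma cone_idx_towardD:
  assumes "cone_idx m u v = cone_toward k n" "u \<noteq> v"
  shows "\<bar>lo n u - lo n v\<bar> \<le> \<tau> * (hi n u - hi n v)"
proof -
  have "8 \<le> m" using k m by simp
  from cone_frame_bounds(3)[OF this assms(2), unfolded assms(1), folded \<tau>, unfolded m frame_toward lo_hi_diff]
  show ?thesis by (simp add: abs_minus_commute)
qed

lemma cone_slope_bounds: "0 < \<tau>" "2 * \<tau> < 1"
  using half_cone_trig[of m] k m \<tau> by auto

end

text \<open>Index 0 is the point closest to the destination. The first inequality of zigzag\_step places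
  p n inside the cone of p (Suc n) that contains the destination, and the second one keeps it near the
  boundary opposite to the destination. The last one is needed because the p j with j < n and the
  parity of Suc n may be closer to p (Suc n) than p n is: it pushes them out of that cone.\<close>

definition zigzag_step :: "real \<Rightarrow> nat \<Rightarrow> complex \<Rightarrow> complex \<Rightarrow> bool" where
  "zigzag_step \<tau> n x y \<longleftrightarrow>
    hi n x + \<tau> * lo n x < lo (Suc n) y + \<tau> * hi (Suc n) y \<and>
    lo (Suc n) y + \<tau> * hi (Suc n) y < hi n x + \<tau> * lo n x + 1 \<and>
    0 < \<tau> * hi (Suc n) y - lo (Suc n) y \<and>
    \<tau> * hi (Suc n) y - lo (Suc n) y < \<tau> * hi n x - lo n x"

text \<open>The range from 1/2 to 1 fixes the scale: its lower end starts the exponential growth,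
  its upper end bounds the initial errors.\<close>

definition zigzag :: "real \<Rightarrow> nat \<Rightarrow> (nat \<Rightarrow> complex) \<Rightarrow> bool" where
  "zigzag \<tau> N p \<longleftrightarrow> 0 < lo 0 (p 0) \<and> lo 0 (p 0) < \<tau> * hi 0 (p 0) \<and>
    1 / 2 < hi 0 (p 0) \<and> hi 0 (p 0) < 1 \<and> (\<forall>n<N. zigzag_step \<tau> n (p n) (p (Suc n)))"

lemma continuous_lo_hi: "continuous_on S (lo n)" "continuous_on S (hi n)"
proof -
  have "lo n = (if even n then (\<lambda>z. - Re z) else (\<lambda>z. - Im z))"
    "hi n = (if even n then (\<lambda>z. - Im z) else (\<lambda>z. - Re z))" by (auto simp: lo_def hi_def)
  then show "continuous_on S (lo n)" "continuous_on S (hi n)"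
    by (auto intro!: continuous_intros)
qed

lemma exists_lo_hi: obtains z where "lo n z = a" "hi n z = b"
  using that[of "if even n then Complex (- a) (- b) else Complex (- b) (- a)"]
  by (auto simp: lo_def hi_def)

text \<open>The constraints on the next point are strict, so they cut out an open set; once it is
  shown nonempty, it contains a point in general position with the earlier ones.\<close>

lemma zigzag_exists:
  assumes "0 < \<tau>"
  shows "\<exists>p. zigzag \<tau> N p \<and> general_position m (insert 0 (p ` {..N}))"
proof (induction N)
  case 0
  define U where "U = {z. 0 < lo 0 z} \<inter> {z. lo 0 z < \<tau> * hi 0 z} \<inter> {z. 1 / 2 < hi 0 z} \<inter> {z. hi 0 z < 1}"
  have o: "open U" unfolding U_def
    by (intro open_Int open_Collect_less continuous_intros continuous_lo_hi)
  obtain z where z: "lo 0 z = \<tau> / 2" "hi 0 z = 3 / 4" by (rule exists_lo_hi)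
  have "z \<in> U" using assms unfolding U_def Int_iff mem_Collect_eq z by auto
  then obtain p where "p \<in> U" "general_position m (insert p {0})"
    using general_position_extend[OF o _ _ general_position_singleton[of m 0]] by auto
  then have "zigzag \<tau> 0 (\<lambda>_. p) \<and> general_position m (insert 0 ((\<lambda>_. p) ` {..0::nat}))"
    by (simp add: zigzag_def U_def insert_commute)
  then show ?case by blast
next
  case (Suc N)
  then obtain p where p: "zigzag \<tau> N p" "general_position m (insert 0 (p ` {..N}))" by blast
  define U where "U = {y. zigzag_step \<tau> N (p N) y}"
  have o: "open U" unfolding U_def zigzag_step_def
    by (intro open_Collect_conj open_Collect_less continuous_intros continuous_lo_hi)
  define s where "s = (\<tau> * hi N (p N) - lo N (p N)) / 2"
  have s: "0 < s"
  proof (cases N)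
    case 0
    then show ?thesis using p(1) by (simp add: s_def zigzag_def)
  next
    case (Suc n)
    then have "zigzag_step \<tau> n (p n) (p (Suc n))" using p(1) by (simp add: zigzag_def)
    then show ?thesis unfolding s_def Suc by (simp add: zigzag_step_def)
  qed
  define g where "g = hi N (p N) + \<tau> * lo N (p N) + 1 / 2"
  \<comment> \<open>This solves \<open>lo + \<tau> * hi = g\<close> and
    \<open>\<tau> * hi - lo = s\<close>, with \<open>g\<close> in the middle of its allowed range
    and \<open>s\<close> half the previous offset.\<close>
  obtain z where z: "lo (Suc N) z = (g - s) / 2" "hi (Suc N) z = (g + s) / (2 * \<tau>)"
    by (rule exists_lo_hi)
  have e: "\<tau> * hi (Suc N) z = (g + s) / 2" unfolding z using assms by (simp add: field_simps)
  have "lo (Suc N) z + \<tau> * hi (Suc N) z = g" "\<tau> * hi (Suc N) z - lo (Suc N) z = s"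
    unfolding e z(1) by (simp_all add: field_simps)
  then have "z \<in> U" unfolding U_def mem_Collect_eq zigzag_step_def
    using s by (auto simp: g_def s_def)
  then obtain y where y: "y \<in> U" "general_position m (insert y (insert 0 (p ` {..N})))"
    using general_position_extend[OF o _ _ p(2)] by auto
  define q where "q = p(Suc N := y)"
  have "zigzag \<tau> (Suc N) q" using p(1) y(1) unfolding zigzag_def q_def U_def
    by (auto simp: less_Suc_eq)
  moreover have "q ` {..Suc N} = insert y (p ` {..N})" unfolding q_def atMost_Suc by auto
  then have "general_position m (insert 0 (q ` {..Suc N}))" using y(2) by (simp add: insert_commute)
  ultimately show ?case by blast
qed

section \<open>Routing along a zigzag and its length\<close>

context
  fixes k m N :: nat and \<tau> :: real and p :: "nat \<Rightarrow> complex"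
  assumes k: "k \<ge> 1" and m: "m = 4 * k + 4" and \<tau>: "\<tau> = tan (cone_angle m / 2)"
    and zz: "zigzag \<tau> N p"
begin

private abbreviation A where "A n \<equiv> lo n (p n)"
private abbreviation B where "B n \<equiv> hi n (p n)"

lemma zigzag_stepD:
  assumes "n < N"
  shows "B n + \<tau> * A n < A (Suc n) + \<tau> * B (Suc n)"
    "A (Suc n) + \<tau> * B (Suc n) < B n + \<tau> * A n + 1"
    "\<tau> * B (Suc n) - A (Suc n) < \<tau> * B n - A n"
  using zz assms unfolding zigzag_def zigzag_step_def by auto

lemma zigzag_pos:
  "n \<le> N \<Longrightarrow> 0 < A n \<and> A n < \<tau> * B n \<and> A n < B n"
proof (induction n)
  case 0
  have "\<tau> * B 0 \<le> 1 * B 0" using cone_slope_bounds[OF k m \<tau>] zz by (intro mult_right_mono) (auto simp: zigzag_def)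
  then show ?case using zz unfolding zigzag_def by linarith
next
  case (Suc n)
  then have IH: "0 < A n" "A n < \<tau> * B n" "A n < B n" and nN: "n < N" by auto
  note st = zigzag_stepD[OF nN]
  note tb = cone_slope_bounds[OF k m \<tau>]
  have o: "0 < \<tau> * B (Suc n) - A (Suc n)"
    using zz nN unfolding zigzag_def zigzag_step_def by auto
  have "\<tau> * B n < 1 * B n" using IH tb by (intro mult_strict_right_mono) auto
  moreover have "\<tau> * A n > 0" using IH tb by simp
  \<comment> \<open>Subtracting the offset bound from the first inequality bounds
    \<open>2 * A (Suc n)\<close> below by
    \<open>B n + \<tau> * A n - (\<tau> * B n - A n)\<close>.\<close>
  ultimately have a: "0 < A (Suc n)" using st IH by linarith
  then have "0 < \<tau> * B (Suc n)" using o by linarith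
  then have "0 < B (Suc n)" using tb zero_less_mult_pos by blast
  then have "\<tau> * B (Suc n) < 1 * B (Suc n)" using tb by (intro mult_strict_right_mono) auto
  then show ?case using a o by simp
qed

text \<open>\<open>B n\<close> lies below \<open>A (Suc n) + \<tau> * B (Suc n)\<close>, whose first
  term is below \<open>\<tau> * B (Suc n)\<close>; as \<open>2 * \<tau> < 1\<close>, the growth is
  geometric.\<close>

lemma zigzag_growth:
  assumes "n < N"
  shows "B n < 2 * \<tau> * B (Suc n)"
proof -
  have "0 < \<tau> * A n" using zigzag_pos[of n] assms cone_slope_bounds[OF k m \<tau>] by simp
  moreover have "A (Suc n) < \<tau> * B (Suc n)" using zigzag_pos[of "Suc n"] assms by simp
  ultimately show ?thesis using zigzag_stepD(1)[OF assms] by linarith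
qed

lemma zigzag_mono_Suc:
  assumes "n < N"
  shows "B n < B (Suc n)" "A n < A (Suc n)"
proof -
  note tb = cone_slope_bounds[OF k m \<tau>]
  have "B (Suc n) > 0" using zigzag_pos[of "Suc n"] assms by simp
  then have "2 * \<tau> * B (Suc n) < 1 * B (Suc n)" using tb by (intro mult_strict_right_mono) auto
  then show 1: "B n < B (Suc n)" using zigzag_growth[OF assms] by linarith
  then have "\<tau> * B n < \<tau> * B (Suc n)" using tb by simp
  then show "A n < A (Suc n)" using zigzag_stepD(3)[OF assms] by linarith
qed

lemma zigzag_mono:
  assumes "i < j" "j \<le> N"
  shows "A i < A j" "B i < B j" "\<tau> * B j - A j < \<tau> * B i - A i"
proof -
  have "Suc i \<le> j" using assms by simp
  then have "A i < A j \<and> B i < B j \<and> \<tau> * B j - A j < \<tau> * B i - A i"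
    using assms(2)
  proof (induction j rule: dec_induct)
    case base
    then show ?case using zigzag_mono_Suc[of i] zigzag_stepD[of i] by simp
  next
    case (step j)
    then show ?case using zigzag_mono_Suc[of j] zigzag_stepD[of j] by force
  qed
  then show "A i < A j" "B i < B j" "\<tau> * B j - A j < \<tau> * B i - A i" by auto
qed

lemma zigzag_mono_le:
  assumes "i \<le> j" "j \<le> N"
  shows "A i \<le> A j" "B i \<le> B j"
  using zigzag_mono[of i j] assms by (cases "i = j"; simp)+

lemma zigzag_nonzero: "n \<le> N \<Longrightarrow> p n \<noteq> 0"
  using zigzag_pos[of n] lo_hi_0 by (metis less_irrefl)

text \<open>No edge joins \<open>p (Suc n)\<close> to 0: from \<open>p (Suc n)\<close> the point
  \<open>p n\<close> hides 0, and from 0 the point \<open>p (n - 1)\<close> hides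
  \<open>p (Suc n)\<close>, hence 1 \<le> \<open>n\<close>. It remains to see that
  \<open>p n\<close> is closest in the cone toward 0.\<close>

lemma zigzag_route_step:
  assumes n: "1 \<le> n" "n < N"
  shows "route_step m (insert 0 (p ` {..N})) 0 (p (Suc n)) (p n)"
proof -
  define P where "P = insert 0 (p ` {..N})"
  note tb = cone_slope_bounds[OF k m \<tau>]
  note st = zigzag_stepD[OF n(2)]
  have inP: "p (Suc n) \<in> P" "p n \<in> P" "p (n - 1) \<in> P" "0 \<in> P"
    using n by (auto simp: P_def)
  have pn: "0 < A n" "A n < \<tau> * B n" "A n < B n" and
    ps: "0 < A (Suc n)" "A (Suc n) < \<tau> * B (Suc n)" "A (Suc n) < B (Suc n)"
    using zigzag_pos[of n] zigzag_pos[of "Suc n"] n by auto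
  have other: "lo (Suc n) (p n) = B n" "hi (Suc n) (p n) = A n"
    using lo_hi_parity(3,4)[of "Suc n" n] by auto
  have t0: "cone_idx m (p (Suc n)) 0 = cone_toward k (Suc n)"
    using ps by (intro cone_idx_toward[OF k m \<tau>]) (simp add: lo_hi_0)
  have tA: "\<tau> * A n \<le> 1 * A n" using tb pn by (intro mult_right_mono) auto
  have t1: "cone_idx m (p (Suc n)) (p n) = cone_toward k (Suc n)"
  proof (rule cone_idx_toward[OF k m \<tau>])
    have "\<bar>A (Suc n) - B n\<bar> < \<tau> * B (Suc n) - \<tau> * A n" using st pn ps tA by linarith
    then show "\<bar>A (Suc n) - lo (Suc n) (p n)\<bar> < \<tau> * (B (Suc n) - hi (Suc n) (p n))"
      unfolding other by (simp add: algebra_simps)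
  qed
  have a0: "cone_idx m 0 (p (Suc n)) = cone_away k (Suc n)"
    using ps by (intro cone_idx_away[OF k m \<tau>]) (simp add: lo_hi_0)
  define l where "l = n - 1"
  have l: "l \<le> N" "l < Suc n" "even l = even (Suc n)" using n by (auto simp: l_def)
  have la: "lo (Suc n) (p l) = A l" "hi (Suc n) (p l) = B l" using lo_hi_parity(1,2)[OF l(3)] by auto
  have a1: "cone_idx m 0 (p l) = cone_away k (Suc n)"
    using zigzag_pos[OF l(1)] by (intro cone_idx_away[OF k m \<tau>]) (simp add: lo_hi_0 la)
  have "\<not> theta_edge m P 0 (p (Suc n))"
  proof
    assume "theta_edge m P 0 (p (Suc n))"
    then have "proj_len m (cone_away k (Suc n)) 0 (p (Suc n)) \<le> proj_len m (cone_away k (Suc n)) 0 (p l)"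
      unfolding theta_edge_def a0 using a1 inP zigzag_nonzero[OF l(1)] by (auto simp: l_def)
    then show False
      using zigzag_mono(2)[OF l(2)] n unfolding m proj_len_away by (simp add: lo_hi_0 la)
  qed
  moreover have "\<not> theta_edge m P (p (Suc n)) 0"
  proof
    assume "theta_edge m P (p (Suc n)) 0"
    moreover have "p n \<noteq> p (Suc n)" using st pn ps tA other by auto
    ultimately have "proj_len m (cone_toward k (Suc n)) (p (Suc n)) 0 \<le> proj_len m (cone_toward k (Suc n)) (p (Suc n)) (p n)"
      unfolding theta_edge_def t0 using t1 inP by auto
    then show False
      using pn unfolding m proj_len_toward by (simp add: lo_hi_0 other)
  qed
  ultimately have "\<not> theta_adj m P (p (Suc n)) 0" by (simp add: theta_adj_def)
  moreover have "theta_edge m P (p (Suc n)) (p n)"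
    unfolding theta_edge_def t1
  proof (intro conjI ballI impI)
    show "p n \<noteq> p (Suc n)"
      using st pn ps tA other by auto
  next
    fix w assume w: "w \<in> P" and "w \<noteq> p (Suc n) \<and> cone_idx m (p (Suc n)) w = cone_toward k (Suc n)"
    then have wn: "p (Suc n) \<noteq> w" and c: "cone_idx m (p (Suc n)) w = cone_toward k (Suc n)" by auto
    have in_cone: "\<bar>A (Suc n) - lo (Suc n) w\<bar> \<le> \<tau> * (B (Suc n) - hi (Suc n) w)"
      using cone_idx_towardD[OF k m \<tau> c wn] .
    then have in_cone': "\<bar>A (Suc n) - lo (Suc n) w\<bar> \<le> \<tau> * B (Suc n) - \<tau> * hi (Suc n) w"
      by (simp add: algebra_simps)
    consider "w = 0" | j where "w = p j" "j \<le> N" "even j = even (Suc n)"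
      | j where "w = p j" "j \<le> N" "even j \<noteq> even (Suc n)" using w by (auto simp: P_def)
    then have "hi (Suc n) w \<le> A n"
    proof cases
      case 1
      then show ?thesis using pn by (simp add: lo_hi_0)
    next
      case 2
      have e: "lo (Suc n) w = A j" "hi (Suc n) w = B j"
        using lo_hi_parity(1,2)[of j "Suc n"] 2 by auto
      have "j \<noteq> Suc n" using 2 wn by auto
      then consider "j < Suc n" | "Suc n < j" by linarith
      then show ?thesis
      proof cases
        case 1
        \<comment> \<open>Impossible: the decreasing offsets put \<open>p j\<close> outside the
          cone.\<close>
        then show ?thesis using zigzag_mono[of j "Suc n"] n in_cone' unfolding e by auto
      next
        case 2
        then have "\<tau> * B (Suc n) < \<tau> * B j"
          using zigzag_mono(2)[of "Suc n" j] \<open>j \<le> N\<close> tb by simp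
        then show ?thesis using in_cone' unfolding e by linarith
      qed
    next
      case 3
      have e: "lo (Suc n) w = B j" "hi (Suc n) w = A j"
        using lo_hi_parity(3,4)[of "Suc n" j] 3 by auto
      have "j \<noteq> Suc n" using 3 by auto
      then consider "j \<le> n" | "Suc n < j" by linarith
      then show ?thesis
      proof cases
        case 1
        then show ?thesis using zigzag_mono_le(1)[of j n] n unfolding e by simp
      next
        case 2
        note mo = zigzag_mono[OF 2 \<open>j \<le> N\<close>]
        \<comment> \<open>Also impossible: the transverse gap \<open>B j - A (Suc n)\<close> exceeds
          what the cone allows at that depth.\<close>
        have "\<tau> * A (Suc n) < \<tau> * A j" using mo tb by simp
        moreover have "\<tau> * (B (Suc n) - A (Suc n)) < 1 * (B (Suc n) - A (Suc n))"
          using tb ps by (intro mult_strict_right_mono) auto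
        ultimately show ?thesis using mo in_cone' unfolding e by (simp add: algebra_simps)
      qed
    qed
    then show "proj_len m (cone_toward k (Suc n)) (p (Suc n)) (p n) \<le> proj_len m (cone_toward k (Suc n)) (p (Suc n)) w"
      unfolding m proj_len_toward other by simp
  qed (use inP in auto)
  ultimately show ?thesis unfolding route_step_def using t0 t1 by (simp add: P_def)
qed

text \<open>\<open>A n + B n\<close> is the l1 norm of \<open>p n\<close>. If \<open>g\<close> were
  0, the step would follow the cone boundary and its length would be exactly \<open>c\<close> times
  the l1 drop; since \<open>g < 1\<close>, the loss is at most \<open>c + 1\<close>.\<close>

lemma zigzag_step_length:
  assumes n: "n < N"
  defines "\<phi> \<equiv> cone_angle m / 2"
  defines "c \<equiv> 1 / (cos \<phi> - sin \<phi>)"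
  shows "c * (A (Suc n) + B (Suc n)) - c * (A n + B n) - (c + 1) \<le> dist (p (Suc n)) (p n)"
proof -
  have "8 \<le> m" using k m by simp
  note t = half_cone_trig[OF this, folded \<phi>_def, folded \<tau>[folded \<phi>_def]]
  define h where "h = B (Suc n) - A n"
  define g where "g = A (Suc n) + \<tau> * B (Suc n) - B n - \<tau> * A n"
  have g: "0 < g" "g < 1" using zigzag_stepD[OF n] by (auto simp: g_def)
  have pos: "cos \<phi> - sin \<phi> > 0" and c0: "c > 0" using t by (auto simp: c_def)
  define s where "s = B n - A (Suc n)"
  have s: "s = \<tau> * h - g" unfolding s_def g_def h_def by (simp add: algebra_simps)
  have "c * (1 - \<tau>) = 1 / cos \<phi>"
    unfolding c_def using t pos by (simp add: field_simps)
  moreover have "cos \<phi> + sin \<phi> * \<tau> = 1 / cos \<phi>"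
  proof -
    have "(cos \<phi> + sin \<phi> * \<tau>) * cos \<phi> = (cos \<phi>)\<^sup>2 + (sin \<phi>)\<^sup>2"
      using t(3) by (simp add: algebra_simps power2_eq_square)
    then show ?thesis using t(4) by (simp add: field_simps)
  qed
  ultimately have cc: "c * (1 - \<tau>) = cos \<phi> + sin \<phi> * \<tau>" by simp
  have "c * (A (Suc n) + B (Suc n)) - c * (A n + B n) = c * (h - s)"
    unfolding h_def s_def by (simp add: algebra_simps)
  also have "\<dots> = c * (1 - \<tau>) * h + c * g" unfolding s by (simp add: algebra_simps)
  also have "\<dots> = (cos \<phi> * h + sin \<phi> * s) + (c + sin \<phi>) * g" unfolding cc s by (simp add: algebra_simps)
  also have "(c + sin \<phi>) * g \<le> (c + 1) * 1" using g c0 t sin_le_one[of \<phi>] by (intro mult_mono) auto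
  also have "cos \<phi> * h + sin \<phi> * s \<le> dist (p (Suc n)) (p n)"
  proof -
    have other: "lo (Suc n) (p n) = B n" "hi (Suc n) (p n) = A n"
      using lo_hi_parity(3,4)[of "Suc n" n] by auto
    have d: "(dist (p (Suc n)) (p n))\<^sup>2 = s\<^sup>2 + h\<^sup>2"
      unfolding dist_norm cmod_lo_hi[of _ "Suc n"] lo_hi_diff other s_def h_def
      by (simp add: power2_commute)
    \<comment> \<open>Lagrange's identity: the projection onto the boundary direction is at most the
      length.\<close>
    have "(cos \<phi> * h + sin \<phi> * s)\<^sup>2 + (sin \<phi> * h - cos \<phi> * s)\<^sup>2 = ((cos \<phi>)\<^sup>2 + (sin \<phi>)\<^sup>2) * (s\<^sup>2 + h\<^sup>2)"
      by algebra
    then have "(cos \<phi> * h + sin \<phi> * s)\<^sup>2 + (sin \<phi> * h - cos \<phi> * s)\<^sup>2 = (dist (p (Suc n)) (p n))\<^sup>2"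
      unfolding d by simp
    then have "(cos \<phi> * h + sin \<phi> * s)\<^sup>2 \<le> (dist (p (Suc n)) (p n))\<^sup>2"
      using zero_le_power2[of "sin \<phi> * h - cos \<phi> * s"] by linarith
    then show ?thesis by (rule power2_le_imp_le) simp
  qed
  finally show ?thesis by simp
qed

text \<open>Step lengths add up with a bounded error each. The induction starts at
  \<open>p 1\<close>, where any path serves: \<open>A 1 + B 1\<close> is at most
  \<open>3 / \<tau>\<close>, which the error term absorbs.\<close>

lemma zigzag_path:
  assumes "1 \<le> n" "n \<le> N"
  defines "\<phi> \<equiv> cone_angle m / 2"
  defines "c \<equiv> 1 / (cos \<phi> - sin \<phi>)"
  shows "\<exists>xs. routing_path m (insert 0 (p ` {..N})) (p n) 0 xs \<and>
    c * (A n + B n) - (c + 1 + 3 * c / \<tau>) * n \<le> path_length xs"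
  using assms(1,2)
proof (induction n rule: dec_induct)
  case base
  note tb = cone_slope_bounds[OF k m \<tau>]
  have "8 \<le> m" using k m by simp
  note t = half_cone_trig[OF this, folded \<phi>_def]
  have c0: "c > 0" using t by (auto simp: c_def)
  obtain xs where xs: "routing_path m (insert 0 (p ` {..N})) (p 1) 0 xs"
    using routing_path_exists[OF m k, of "insert 0 (p ` {..N})" "p 1" 0] base by auto
  have "A 1 + \<tau> * B 1 < B 0 + \<tau> * A 0 + 1" using zigzag_stepD(2)[of 0] base by simp
  moreover have "\<tau> * A 0 \<le> 1 * 1" using zigzag_pos[of 0] zz tb by (intro mult_mono) (auto simp: zigzag_def)
  ultimately have "A 1 + \<tau> * B 1 < 3" using zz by (auto simp: zigzag_def)
  moreover have "\<tau> * A 1 \<le> 1 * A 1" using zigzag_pos[of 1] base tb by (intro mult_right_mono) auto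
  ultimately have "A 1 + B 1 \<le> 3 / \<tau>" using tb by (simp add: field_simps)
  then have "c * (A 1 + B 1) \<le> c * (3 / \<tau>)" using c0 by (intro mult_left_mono) auto
  then show ?case using xs path_length_nonneg[of xs] c0 by (intro exI[of _ xs]) simp
next
  case (step n)
  then obtain xs where xs: "routing_path m (insert 0 (p ` {..N})) (p n) 0 xs"
    "c * (A n + B n) - (c + 1 + 3 * c / \<tau>) * n \<le> path_length xs" by auto
  note tb = cone_slope_bounds[OF k m \<tau>]
  have "8 \<le> m" using k m by simp
  note t = half_cone_trig[OF this, folded \<phi>_def]
  have c0: "c > 0" using t by (auto simp: c_def)
  have nN: "n < N" using step by simp
  note r = routing_path_Cons[OF zigzag_nonzero zigzag_route_step[OF step(1) nN] xs(1)]
  have "c * (A (Suc n) + B (Suc n)) - c * (A n + B n) - (c + 1) \<le> dist (p (Suc n)) (p n)"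
    using zigzag_step_length[OF nN] unfolding c_def \<phi>_def .
  moreover have "3 * c / \<tau> \<ge> 0" using c0 tb by simp
  moreover have "(c + 1 + 3 * c / \<tau>) * Suc n = (c + 1 + 3 * c / \<tau>) * n + (c + 1 + 3 * c / \<tau>)"
    by (simp add: distrib_left)
  ultimately have "c * (A (Suc n) + B (Suc n)) - (c + 1 + 3 * c / \<tau>) * Suc n \<le> path_length (p (Suc n) # xs)"
    using xs(2) r(2) nN by linarith
  then show ?case using r(1) nN by auto
qed

text \<open>In this form, an error linear in \<open>n\<close> is seen to be negligible against
  \<open>B n\<close>.\<close>

lemma zigzag_exponential: "n \<le> N \<Longrightarrow> 1 / 2 \<le> (2 * \<tau>) ^ n * B n"
proof (induction n)
  case 0
  then show ?case using zz by (simp add: zigzag_def)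
next
  case (Suc n)
  then have "1 / 2 \<le> (2 * \<tau>) ^ n * B n" by simp
  also have "\<dots> \<le> (2 * \<tau>) ^ n * (2 * \<tau> * B (Suc n))"
    using zigzag_growth[of n] Suc.prems cone_slope_bounds[OF k m \<tau>] by (intro mult_left_mono) auto
  finally show ?case by (simp add: mult_ac)
qed

lemma zigzag_dist_bounds:
  assumes "n \<le> N"
  shows "B n \<le> dist (p n) 0" "dist (p n) 0 \<le> B n / cos (cone_angle m / 2)"
proof -
  have "8 \<le> m" using k m by simp
  note t = half_cone_trig[OF this, folded \<tau>]
  note pn = zigzag_pos[OF assms]
  have d: "(dist (p n) 0)\<^sup>2 = (A n)\<^sup>2 + (B n)\<^sup>2" by (simp add: cmod_lo_hi[of _ n])
  then have "(B n)\<^sup>2 \<le> (dist (p n) 0)\<^sup>2" by simp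
  then show "B n \<le> dist (p n) 0" by (rule power2_le_imp_le) simp
  have "(A n)\<^sup>2 \<le> (\<tau> * B n)\<^sup>2" using pn by (intro power_mono) auto
  then have "(dist (p n) 0)\<^sup>2 \<le> (1 + \<tau>\<^sup>2) * (B n)\<^sup>2" unfolding d by (simp add: algebra_simps)
  also have "1 + \<tau>\<^sup>2 = 1 / (cos (cone_angle m / 2))\<^sup>2"
    using t(4) tan_sec[of "cone_angle m / 2"] unfolding \<tau> by (simp add: field_simps)
  finally have "(dist (p n) 0)\<^sup>2 \<le> (B n / cos (cone_angle m / 2))\<^sup>2" by (simp add: power_divide)
  then show "dist (p n) 0 \<le> B n / cos (cone_angle m / 2)"
    by (rule power2_le_imp_le) (use pn t in auto)
qed

text \<open>Offsets decrease from a value below 1, so every point stays within a bounded distance of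
  the cone boundary, where the l1 norm is extremal.\<close>

lemma zigzag_offset_less_1:
  assumes "n \<le> N"
  shows "\<tau> * B n - A n < 1"
proof -
  have "\<tau> * B 0 \<le> 1 * 1" using cone_slope_bounds[OF k m \<tau>] zz by (intro mult_mono) (auto simp: zigzag_def)
  then have "\<tau> * B 0 - A 0 < 1" using zz by (auto simp: zigzag_def)
  then show ?thesis using zigzag_mono(3)[of 0 n] assms by (cases "n = 0") auto
qed

end

text \<open>The ratio equals \<open>c * (cos \<phi> + sin \<phi>)\<close>. The path from
  \<open>p N\<close> falls short of it by at most \<open>c + K * N\<close> in length, less than
  \<open>\<epsilon> * b\<close> for large \<open>N\<close>.\<close>

lemma routing_ratio_lower:
  assumes k: "k \<ge> 1" and m: "m = 4 * k + 4" and "\<epsilon> > 0"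
  defines "\<phi> \<equiv> cone_angle m / 2"
  shows "\<exists>P u w xs. finite P \<and> general_position m P \<and> u \<in> P \<and> w \<in> P \<and> u \<noteq> w \<and>
    routing_path m P u w xs \<and>
    path_length xs \<ge> (1 + 2 * sin \<phi> / (cos \<phi> - sin \<phi>) - \<epsilon>) * dist u w"
proof -
  define \<tau> where "\<tau> = tan \<phi>"
  have \<tau>': "\<tau> = tan (cone_angle m / 2)" by (simp add: \<tau>_def \<phi>_def)
  note tb = cone_slope_bounds[OF k m \<tau>']
  have "8 \<le> m" using k m by simp
  note t = half_cone_trig[OF this, folded \<phi>_def, folded \<tau>_def]
  define c where "c = 1 / (cos \<phi> - sin \<phi>)"
  have pos: "cos \<phi> - sin \<phi> > 0" and c0: "c > 0" using t by (auto simp: c_def)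
  define K where "K = c + 1 + 3 * c / \<tau>"
  have "(\<lambda>n. c * (2 * \<tau>) ^ n + K * (real n * (2 * \<tau>) ^ n)) \<longlonglongrightarrow> c * 0 + K * 0"
    using tb by (intro tendsto_intros LIMSEQ_power_zero powser_times_n_limit_0) auto
  \<comment> \<open>The half matches the constant 1/2 in \<open>zigzag_exponential\<close>.\<close>
  then have "\<forall>\<^sub>F n in sequentially. c * (2 * \<tau>) ^ n + K * (real n * (2 * \<tau>) ^ n) < \<epsilon> / 2"
    using \<open>\<epsilon> > 0\<close> by (intro order_tendstoD(2)[where y = "c * 0 + K * 0"]) auto
  then obtain M where M: "\<And>n. n \<ge> M \<Longrightarrow> c * (2 * \<tau>) ^ n + K * (real n * (2 * \<tau>) ^ n) < \<epsilon> / 2"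
    unfolding eventually_sequentially by blast
  define N where "N = max 1 M"
  have N: "1 \<le> N" "c * (2 * \<tau>) ^ N + K * (real N * (2 * \<tau>) ^ N) < \<epsilon> / 2"
    using M[of N] by (auto simp: N_def)
  obtain p where p: "zigzag \<tau> N p" "general_position m (insert 0 (p ` {..N}))"
    using zigzag_exists tb(1) by blast
  note zz = k m \<tau>' p(1)
  define a b where "a = lo N (p N)" and "b = hi N (p N)"
  obtain xs where xs: "routing_path m (insert 0 (p ` {..N})) (p N) 0 xs"
    "c * (a + b) - K * N \<le> path_length xs"
    using zigzag_path[OF zz N(1) order_refl] unfolding c_def K_def \<phi>_def a_def b_def by blast
  define D where "D = dist (p N) 0"
  have D: "b \<le> D" "D \<le> b / cos \<phi>"
    using zigzag_dist_bounds[OF zz order_refl] unfolding D_def b_def \<phi>_def by auto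
  have q: "(2 * \<tau>) ^ N > 0" using tb by simp
  have "(2 * \<tau>) ^ N * (c + K * N) < (2 * \<tau>) ^ N * (\<epsilon> * b)"
  proof -
    have "(2 * \<tau>) ^ N * (c + K * N) < \<epsilon> * (1 / 2)" using N(2) by (simp add: algebra_simps)
    also have "\<dots> \<le> \<epsilon> * ((2 * \<tau>) ^ N * b)"
      using zigzag_exponential[OF zz order_refl] \<open>\<epsilon> > 0\<close> unfolding b_def by (intro mult_left_mono) auto
    finally show ?thesis by (simp add: mult_ac)
  qed
  then have big: "c + K * N < \<epsilon> * b" using q mult_less_cancel_left_pos by blast
  have R: "1 + 2 * sin \<phi> / (cos \<phi> - sin \<phi>) = c * (cos \<phi> + sin \<phi>)"
    unfolding c_def using pos by (simp add: field_simps)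
  have "c * (cos \<phi> + sin \<phi>) * D \<le> c * (cos \<phi> + sin \<phi>) * (b / cos \<phi>)"
    using D c0 t by (intro mult_left_mono) auto
  also have "\<dots> = c * (b + \<tau> * b)" using t(3,4) by (simp add: field_simps)
  also have "\<dots> \<le> c * (a + b) + c"
  proof -
    have "b + \<tau> * b \<le> (a + b) + 1"
      using zigzag_offset_less_1[OF zz order_refl] unfolding a_def b_def by simp
    then have "c * (b + \<tau> * b) \<le> c * ((a + b) + 1)" using c0 by (intro mult_left_mono) auto
    then show ?thesis by (simp add: algebra_simps)
  qed
  finally have "c * (cos \<phi> + sin \<phi>) * D \<le> path_length xs + (c + K * N)" using xs(2) by linarith
  moreover have "\<epsilon> * b \<le> \<epsilon> * D" using D \<open>\<epsilon> > 0\<close> by simp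
  ultimately have "(c * (cos \<phi> + sin \<phi>) - \<epsilon>) * D \<le> path_length xs"
    using big by (simp add: left_diff_distrib)
  then have "(1 + 2 * sin \<phi> / (cos \<phi> - sin \<phi>) - \<epsilon>) * dist (p N) 0 \<le> path_length xs"
    unfolding R D_def .
  moreover have "p N \<noteq> 0" using zigzag_nonzero[OF zz order_refl] .
  ultimately show ?thesis using p(2) xs(1)
    by (intro exI[of _ "insert 0 (p ` {..N})"] exI[of _ "p N"] exI[of _ 0] exI[of _ xs]) simp
qed

text \<open>The existence clause keeps the bound over all routing paths from being vacuous.\<close>

theorem mainTheorem10:
  fixes k :: nat
  assumes "k \<ge> 1"
  defines "\<theta> \<equiv> 2 * pi / real (4 * k + 4)"
  defines "R \<equiv> 1 + 2 * sin (\<theta> / 2) / (cos (\<theta> / 2) - sin (\<theta> / 2))"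
  shows "(\<forall>P u w. finite P \<and> general_position (4 * k + 4) P \<and> u \<in> P \<and> w \<in> P \<longrightarrow>
            (\<exists>xs. routing_path (4 * k + 4) P u w xs) \<and>
            (\<forall>xs. routing_path (4 * k + 4) P u w xs \<longrightarrow> path_length xs \<le> R * dist u w))
       \<and> (\<forall>\<epsilon>>0. \<exists>P u w xs. finite P \<and> general_position (4 * k + 4) P \<and> u \<in> P \<and> w \<in> P \<and>
            u \<noteq> w \<and> routing_path (4 * k + 4) P u w xs \<and> path_length xs \<ge> (R - \<epsilon>) * dist u w)"
proof -
  have \<theta>: "\<theta> = cone_angle (4 * k + 4)" unfolding \<theta>_def cone_angle_def ..
  show ?thesis
    using routing_path_exists[OF refl \<open>k \<ge> 1\<close>] routing_ratio_upper[OF refl \<open>k \<ge> 1\<close>]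
      routing_ratio_lower[OF \<open>k \<ge> 1\<close> refl]
    unfolding R_def \<theta> by auto
qed

end
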